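(* Let $0<q<1$ and $\alpha>-1$, and let $$w(x)=\frac{(q^4x^4;q^4)_\infty\,|x|^\alpha}{(1-q^4)^{\alpha/4}}$$ on the $q$-exponential lattice $L=\{\pm q^k : k=0,1,2,\ldots\}$. Let $(p_n)_{n\ge 0}$ be the orthonormal polynomials with positive leading coefficients for $w$ with respect to the $q$-integral on $[-1,1]$, and let $a_n$ $(n\ge1)$, $b_n$ $(n\geq 0)$ be their recurrence coefficients. Then $b_n=0$ for all $n\ge 0$, and, setting $y_0=0$ and $y_n=a_n^2q^{1-n}$ for $n\ge 1$, one has for every $n\ge 1$ $$q^{n-\alpha}\left(y_ny_{n+1}+q^\alpha\right)\left(y_ny_{n-1}+q^\alpha\right)=\begin{cases} q^\alpha-q^{-\alpha}y_n^2, & n \text{ even},\\ 1-y_n^2, & n\text{ odd}.\end{cases}$$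
   Context: $(a;q)_\infty=\prod_{j=0}^\infty(1-aq^j)$. The $q$-integral is $$\int_{-1}^1 f(x)\,d_qx=(1-q)\sum_{k=0}^\infty f(q^k)q^k+(1-q)\sum_{k=0}^\infty f(-q^k)q^k .$$ The orthonormal polynomials $p_n$ (of degree $n$, with positive leading coefficient) are determined by $\int_{-1}^1p_n(x)p_m(x)w(x)\,d_qx=\delta_{mn}$ for $m,n\ge0$. They satisfy a three-term recurrence $xp_n(x)=a_{n+1}p_{n+1}(x)+b_np_n(x)+a_np_{n-1}(x)$ for $n\ge0$, with $p_{-1}=0$, which defines the recurrence coefficients $a_n>0$ ($n\ge1$) and $b_n$ ($n\ge 0$). *)

theory Defs
  imports "HOL-Analysis.Analysis" "HOL-Computational_Algebra.Polynomial"
begin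

definition qpoch_inf :: "real \<Rightarrow> real \<Rightarrow> real" where
  "qpoch_inf a q = (\<Prod>j. 1 - a * q ^ j)"

definition q_integral :: "real \<Rightarrow> (real \<Rightarrow> real) \<Rightarrow> real" where
  "q_integral q f =
     (1 - q) * (\<Sum>k. f (q ^ k) * q ^ k) + (1 - q) * (\<Sum>k. f (- (q ^ k)) * q ^ k)"

text \<open>Only the values of the weight on the lattice of points \<open>q ^ k\<close> and \<open>- (q ^ k)\<close> enter
  the \<open>q\<close>-integral, so it is harmless to define it by the same formula on the whole real line.\<close>

definition freud_weight :: "real \<Rightarrow> real \<Rightarrow> real \<Rightarrow> real" where
  "freud_weight q \<alpha> x =
     qpoch_inf (q ^ 4 * x ^ 4) (q ^ 4) * \<bar>x\<bar> powr \<alpha> / (1 - q ^ 4) powr (\<alpha> / 4)"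

definition orthonormal_polys ::
    "real \<Rightarrow> (real \<Rightarrow> real) \<Rightarrow> (nat \<Rightarrow> real poly) \<Rightarrow> bool" where
  "orthonormal_polys q w p \<longleftrightarrow>
     (\<forall>n. degree (p n) = n \<and> lead_coeff (p n) > 0) \<and>
     (\<forall>m n. q_integral q (\<lambda>x. poly (p n) x * poly (p m) x * w x) = (if m = n then 1 else 0))"

text \<open>The conditional encodes the convention \<open>p\<^sub>-\<^sub>1 = 0\<close>; the value \<open>a 0\<close> is irrelevant.\<close>

definition recurrence_coeffs ::
    "(nat \<Rightarrow> real poly) \<Rightarrow> (nat \<Rightarrow> real) \<Rightarrow> (nat \<Rightarrow> real) \<Rightarrow> bool" where
  "recurrence_coeffs p a b \<longleftrightarrow>
     (\<forall>n\<ge>1. a n > 0) \<and>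
     (\<forall>n. [:0, 1:] * p n =
        smult (a (n + 1)) (p (n + 1)) + smult (b n) (p n) +
        (if n = 0 then 0 else smult (a n) (p (n - 1))))"

end

theory Submission
  imports Defs
begin

text \<open>
  The weight satisfies the Pearson equation \<open>w (q x) (1 - q\<^sup>4 x\<^sup>4) = q\<^sup>\<alpha> w x\<close>. Shifting the lattice
  by one step turns it into an identity for the functional \<open>L f = \<integral> f w d\<^sub>q x\<close>, namely
  \<open>q\<^sup>\<alpha>\<^sup>+\<^sup>1 L (f (q x)) = L ((1 - x\<^sup>4) f x)\<close>; there is no boundary term because \<open>1 - x\<^sup>4\<close>
  vanishes at the end points. Only this identity, the linearity of \<open>L\<close> and its invariance under
  \<open>x \<mapsto> - x\<close> enter the rest of the argument. Invariance under reflection makes \<open>p\<^sub>n\<close> even or odd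
  with \<open>n\<close> and forces \<open>b\<^sub>n = 0\<close>.

  Write \<open>Q = q\<^sup>\<alpha>\<close> and \<open>s\<^sub>n = a\<^sub>1\<^sup>2 + \<dots> + a\<^sub>n\<^sub>-\<^sub>1\<^sup>2\<close>; then \<open>- s\<^sub>n\<close> is the coefficient of \<open>x\<^sup>n\<^sup>-\<^sup>2\<close> in
  the monic orthogonal polynomial of degree \<open>n\<close>. The number \<open>L (p\<^sub>n\<^sub>+\<^sub>2 (q x) p\<^sub>n x)\<close> can be computed
  from the two highest coefficients of \<open>p\<^sub>n\<^sub>+\<^sub>2 (q x)\<close>, and also, after the identity above, from
  those of \<open>x\<^sup>4 p\<^sub>n (x / q)\<close>. Comparing the results gives (\<open>sum_relation\<close>)
  \<open>Q (1 - q\<^sup>2) s\<^sub>n = y\<^sub>n y\<^sub>n\<^sub>-\<^sub>1 (s\<^sub>n\<^sub>+\<^sub>2 - q\<^sup>2 s\<^sub>n\<^sub>-\<^sub>2)\<close> for \<open>n \<ge> 2\<close>, while \<open>f = p\<^sub>0\<^sup>2\<close> gives the initial condition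
  \<open>a\<^sub>1\<^sup>2 (a\<^sub>1\<^sup>2 + a\<^sub>2\<^sup>2) = 1 - q Q\<close> (\<open>first_relation\<close>).

  This relation for the sums has higher order than the claimed one. It is integrated by a closed form
  for \<open>s\<^sub>n\<close> in terms of \<open>y\<^sub>n\<close> and \<open>y\<^sub>n\<^sub>-\<^sub>1\<close>. With \<open>(A, B) = (Q, 1)\<close> for even \<open>n\<close>,
  \<open>(A, B) = (1, Q)\<close> for odd \<open>n\<close>, and \<open>D\<^sub>n = y\<^sub>n y\<^sub>n\<^sub>-\<^sub>1 + Q\<close>, the closed form and the claim
  (multiplied by \<open>Q\<close>) are
    \<open>D\<^sub>n ((1 - q\<^sup>2) s\<^sub>n + q\<^sup>n\<^sup>-\<^sup>1 (y\<^sub>n + q y\<^sub>n\<^sub>-\<^sub>1)) = A y\<^sub>n\<^sub>-\<^sub>1 + B y\<^sub>n\<close> and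
    \<open>q\<^sup>n D\<^sub>n D\<^sub>n\<^sub>+\<^sub>1 = Q A - B y\<^sub>n\<^sup>2\<close>.
  They are proved by one induction: the closed form and the claim at \<open>n\<close> give the closed form at
  \<open>n + 1\<close> by \<open>s\<^sub>n\<^sub>+\<^sub>1 = s\<^sub>n + a\<^sub>n\<^sup>2\<close> (\<open>qdP_step_add\<close>), and then the relation for the sums gives the
  claim at \<open>n + 1\<close> (\<open>qdP_step_mult\<close>).
\<close>

section \<open>The weight and its functional\<close>

lemma qpoch_inf_bounds:
  assumes "0 < q" "q < 1" "0 \<le> a" "a \<le> 1"
  shows "0 \<le> qpoch_inf a q" and "qpoch_inf a q \<le> 1"
    and "a < 1 \<Longrightarrow> qpoch_inf a q = (1 - a) * qpoch_inf (a * q) q"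
proof -
  have "summable (\<lambda>j. norm (a * q ^ j))"
    using assms by (auto simp: abs_mult intro!: summable_mult summable_geometric)
  hence "abs_convergent_prod (\<lambda>j. 1 - a * q ^ j)"
    by (intro summable_imp_abs_convergent_prod) simp
  hence conv: "convergent_prod (\<lambda>j. 1 - a * q ^ j)"
    by (rule abs_convergent_prod_imp_convergent_prod)
  have le1: "a * q ^ j \<le> 1" for j
    using assms by (intro mult_le_one) (auto intro: power_le_one)
  have lim: "(\<lambda>n. \<Prod>j\<le>n. 1 - a * q ^ j) \<longlonglongrightarrow> qpoch_inf a q"
    unfolding qpoch_inf_def by (rule convergent_prod_LIMSEQ[OF conv])
  show "0 \<le> qpoch_inf a q"
    by (rule LIMSEQ_le_const[OF lim]) (use le1 in \<open>auto intro!: prod_nonneg\<close>)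
  show "qpoch_inf a q \<le> 1"
    by (rule LIMSEQ_le_const2[OF lim]) (use le1 assms in \<open>auto intro!: prod_le_1\<close>)
  show "qpoch_inf a q = (1 - a) * qpoch_inf (a * q) q" if "a < 1"
  proof -
    have "a * q ^ j < 1" for j
      using mult_left_mono[of "q ^ j" 1 a] power_le_one[of q j] assms that by simp
    hence "1 - a * q ^ j \<noteq> 0" for j by (metis less_irrefl eq_iff_diff_eq_0)
    from prodinf_split_head[OF conv this] show ?thesis
      using that by (simp add: qpoch_inf_def field_simps)
  qed
qed

lemma freud_weight_minus: "freud_weight q \<alpha> (- x) = freud_weight q \<alpha> x"
  by (simp add: freud_weight_def)

text \<open>Passing from \<open>x\<close> to \<open>q x\<close> removes the first factor of the infinite product.\<close>

lemma freud_weight_pearson: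
  assumes "0 < q" "q < 1" "0 < x" "x \<le> 1"
  shows "freud_weight q \<alpha> (q * x) * (1 - (q * x) ^ 4) = q powr \<alpha> * freud_weight q \<alpha> x"
proof -
  have q4: "q ^ 4 < 1" "0 < q ^ 4" "q ^ 4 \<noteq> 1" using assms power_less_one_iff[of q 4] by auto
  have x4: "x ^ 4 \<le> 1" "0 < x ^ 4" using assms by (auto intro: power_le_one)
  have lt: "q ^ 4 * x ^ 4 < 1"
    using mult_left_mono[OF x4(1), of "q ^ 4"] q4 by linarith
  have "qpoch_inf (q ^ 4 * x ^ 4) (q ^ 4) =
      (1 - q ^ 4 * x ^ 4) * qpoch_inf (q ^ 4 * x ^ 4 * q ^ 4) (q ^ 4)"
    using qpoch_inf_bounds(3)[of "q ^ 4" "q ^ 4 * x ^ 4"] lt q4 x4 by simp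
  thus ?thesis using assms
    by (simp add: freud_weight_def powr_mult abs_mult power_mult_distrib mult_ac)
qed

lemma freud_weight_bound:
  assumes "0 < q" "q < 1" "0 < x" "x \<le> 1"
  shows "\<bar>freud_weight q \<alpha> x\<bar> \<le> x powr \<alpha> / (1 - q ^ 4) powr (\<alpha> / 4)"
proof -
  have q4: "q ^ 4 < 1" "0 < q ^ 4" using assms power_less_one_iff[of q 4] by auto
  have x4: "x ^ 4 \<le> 1" "0 < x ^ 4" using assms by (auto intro: power_le_one)
  have "q ^ 4 * x ^ 4 \<le> 1" using mult_left_mono[OF x4(1), of "q ^ 4"] q4 by linarith
  with qpoch_inf_bounds(1,2)[of "q ^ 4" "q ^ 4 * x ^ 4"] q4 x4
  have "0 \<le> qpoch_inf (q ^ 4 * x ^ 4) (q ^ 4)" "qpoch_inf (q ^ 4 * x ^ 4) (q ^ 4) \<le> 1"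
    by simp_all
  thus ?thesis using assms
    by (auto simp: freud_weight_def abs_mult intro!: divide_right_mono mult_left_le_one_le)
qed

text \<open>On the lattice the terms are dominated by a geometric series of ratio \<open>q\<^sup>\<alpha>\<^sup>+\<^sup>1\<close>; this is
  where \<open>\<alpha> > - 1\<close> is used.\<close>

lemma summable_freud:
  assumes "0 < q" "q < 1" "\<alpha> > -1" "\<sigma> \<in> {1, -1}"
  shows "summable (\<lambda>k. poly f (\<sigma> * q ^ k) * freud_weight q \<alpha> (\<sigma> * q ^ k) * q ^ k)"
proof -
  have "compact (poly f ` {-1..1})"
    by (intro compact_continuous_image continuous_intros) auto
  then obtain M where M: "\<And>x. x \<in> {-1..1} \<Longrightarrow> \<bar>poly f x\<bar> \<le> M"
    by (metis (no_types, lifting) compact_imp_bounded bounded_iff imageI real_norm_def)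
  define K where "K = (1 - q ^ 4) powr (\<alpha> / 4)"
  have K: "K \<ge> 0" by (simp add: K_def)
  show ?thesis
  proof (rule summable_comparison_test'[where N = 0])
    have "q powr (\<alpha> + 1) < 1" using assms powr_less_mono2[of "\<alpha> + 1" q 1] by simp
    thus "summable (\<lambda>k. M / K * (q powr (\<alpha> + 1)) ^ k)"
      by (intro summable_mult summable_geometric) simp
  next
    fix k :: nat
    have qk: "0 < q ^ k" "q ^ k \<le> 1" using assms by (auto intro: power_le_one)
    have pow: "(q ^ k) powr \<alpha> * q ^ k = (q powr (\<alpha> + 1)) ^ k"
      using assms by (simp add: powr_add power_mult_distrib powr_powr mult.commute
          flip: powr_realpow)
    have f: "\<bar>poly f (\<sigma> * q ^ k)\<bar> \<le> M"
      by (rule M) (use qk assms(4) less_imp_le[OF less_trans[OF _ qk(1), of "-1"]] in auto)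
    have w: "\<bar>freud_weight q \<alpha> (\<sigma> * q ^ k)\<bar> \<le> (q ^ k) powr \<alpha> / K"
      using freud_weight_bound[OF assms(1,2) qk, of \<alpha>] assms(4)
      by (auto simp: freud_weight_minus K_def)
    have "norm (poly f (\<sigma> * q ^ k) * freud_weight q \<alpha> (\<sigma> * q ^ k) * q ^ k)
        = \<bar>poly f (\<sigma> * q ^ k)\<bar> * \<bar>freud_weight q \<alpha> (\<sigma> * q ^ k)\<bar> * q ^ k"
      using qk by (simp add: abs_mult)
    also have "\<dots> \<le> M * ((q ^ k) powr \<alpha> / K) * q ^ k"
      using qk f w K by (intro mult_right_mono mult_mono) auto
    also have "\<dots> = M / K * (q powr (\<alpha> + 1)) ^ k" by (simp flip: pow)
    finally show "norm (poly f (\<sigma> * q ^ k) * freud_weight q \<alpha> (\<sigma> * q ^ k) * q ^ k)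
        \<le> M / K * (q powr (\<alpha> + 1)) ^ k" .
  qed
qed

definition freud_functional :: "real \<Rightarrow> real \<Rightarrow> real poly \<Rightarrow> real" where
  "freud_functional q \<alpha> f = q_integral q (\<lambda>x. poly f x * freud_weight q \<alpha> x)"

lemma freud_functional_eq:
  "freud_functional q \<alpha> f =
    (1 - q) * (\<Sum>k. poly f (1 * q ^ k) * freud_weight q \<alpha> (1 * q ^ k) * q ^ k) +
    (1 - q) * (\<Sum>k. poly f ((-1) * q ^ k) * freud_weight q \<alpha> ((-1) * q ^ k) * q ^ k)"
  by (simp add: freud_functional_def q_integral_def)

lemma freud_functional_add:
  assumes "0 < q" "q < 1" "\<alpha> > -1"
  shows "freud_functional q \<alpha> (f + g) = freud_functional q \<alpha> f + freud_functional q \<alpha> g"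
proof -
  have "(\<Sum>k. poly (f + g) (\<sigma> * q ^ k) * freud_weight q \<alpha> (\<sigma> * q ^ k) * q ^ k) =
      (\<Sum>k. poly f (\<sigma> * q ^ k) * freud_weight q \<alpha> (\<sigma> * q ^ k) * q ^ k) +
      (\<Sum>k. poly g (\<sigma> * q ^ k) * freud_weight q \<alpha> (\<sigma> * q ^ k) * q ^ k)"
    if "\<sigma> \<in> {1, -1}" for \<sigma>
    using suminf_add[OF summable_freud[OF assms that] summable_freud[OF assms that], of f g]
    by (simp add: algebra_simps)
  from this[of 1] this[of "-1"] show ?thesis
    unfolding freud_functional_eq by (simp add: algebra_simps)
qed

lemma freud_functional_smult:
  assumes "0 < q" "q < 1" "\<alpha> > -1"
  shows "freud_functional q \<alpha> (smult c f) = c * freud_functional q \<alpha> f"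
proof -
  have "(\<Sum>k. poly (smult c f) (\<sigma> * q ^ k) * freud_weight q \<alpha> (\<sigma> * q ^ k) * q ^ k) =
      c * (\<Sum>k. poly f (\<sigma> * q ^ k) * freud_weight q \<alpha> (\<sigma> * q ^ k) * q ^ k)"
    if "\<sigma> \<in> {1, -1}" for \<sigma>
    using suminf_mult[OF summable_freud[OF assms that], of c f] by (simp add: mult_ac)
  from this[of 1] this[of "-1"] show ?thesis
    unfolding freud_functional_eq by (simp add: algebra_simps)
qed

lemma freud_functional_reflect:
  "freud_functional q \<alpha> (f \<circ>\<^sub>p [:0, -1:]) = freud_functional q \<alpha> f"
  by (simp add: freud_functional_def q_integral_def poly_pcompose freud_weight_minus)

text \<open>The Pearson equation, integrated: the two sides are the same series up to a shift of the
  summation index.\<close>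

lemma freud_functional_scale:
  assumes "0 < q" "q < 1" "\<alpha> > -1"
  shows "q * q powr \<alpha> * freud_functional q \<alpha> (f \<circ>\<^sub>p [:0, q:]) =
    freud_functional q \<alpha> (f * (1 - monom 1 4))"
proof -
  have "(\<Sum>k. poly (f * (1 - monom 1 4)) (\<sigma> * q ^ k) * freud_weight q \<alpha> (\<sigma> * q ^ k) * q ^ k) =
      q * q powr \<alpha> * (\<Sum>k. poly (f \<circ>\<^sub>p [:0, q:]) (\<sigma> * q ^ k) * freud_weight q \<alpha> (\<sigma> * q ^ k) * q ^ k)"
    (is "(\<Sum>k. ?u k) = _ * (\<Sum>k. ?v k)")
    if \<sigma>: "\<sigma> \<in> {1, -1}" for \<sigma>
  proof -
    have "?u (Suc k) = q * q powr \<alpha> * ?v k" for k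
    proof -
      have "freud_weight q \<alpha> (q * q ^ k) * (1 - (q * q ^ k) ^ 4) =
          q powr \<alpha> * freud_weight q \<alpha> (q ^ k)"
        using assms by (intro freud_weight_pearson) (auto intro: power_le_one)
      hence "freud_weight q \<alpha> (\<sigma> * (q * q ^ k)) * (1 - (\<sigma> * (q * q ^ k)) ^ 4) =
          q powr \<alpha> * freud_weight q \<alpha> (\<sigma> * q ^ k)"
        using \<sigma> by (auto simp: freud_weight_minus)
      thus ?thesis by (simp add: poly_pcompose poly_monom mult_ac)
    qed
    \<comment> \<open>The term that the shift leaves over vanishes, since \<open>1 - x ^ 4\<close> is zero at \<open>\<sigma>\<close>.\<close>
    moreover have "?u 0 = 0" using \<sigma> by (auto simp: poly_monom)
    ultimately show ?thesis
      using suminf_split_head[OF summable_freud[OF assms \<sigma>], of "f * (1 - monom 1 4)"]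
        suminf_mult[OF summable_freud[OF assms \<sigma>], of "q * q powr \<alpha>" "f \<circ>\<^sub>p [:0, q:]"]
      by (simp only: diff_zero)
  qed
  from this[of 1] this[of "-1"] show ?thesis
    unfolding freud_functional_eq by (simp add: algebra_simps)
qed

section \<open>Orthonormal polynomials of a reflection-invariant functional\<close>

locale even_orthonormal =
  fixes L :: "real poly \<Rightarrow> real" and p :: "nat \<Rightarrow> real poly" and a b :: "nat \<Rightarrow> real"
  assumes L_add: "L (f + g) = L f + L g"
    and L_smult: "L (smult k f) = k * L f"
    and L_reflect: "L (f \<circ>\<^sub>p [:0, -1:]) = L f"
    and degree_p: "degree (p n) = n"
    and lead_coeff_p: "lead_coeff (p n) > 0"
    and ortho: "L (p n * p m) = (if m = n then 1 else 0)"
    and rec_coeffs: "recurrence_coeffs p a b"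
begin

text \<open>The value at \<open>0\<close> is the coefficient in front of \<open>p\<^sub>-\<^sub>1 = 0\<close>. Setting it to zero makes
  \<open>asq_sum\<close> satisfy its recursion and describe the subleading coefficients from \<open>n = 0\<close> on.\<close>

definition asq :: "nat \<Rightarrow> real" where "asq n = (if n = 0 then 0 else (a n)\<^sup>2)"

definition asq_sum :: "nat \<Rightarrow> real" where "asq_sum n = (\<Sum>j<n. asq j)"

abbreviation \<gamma> :: "nat \<Rightarrow> real" where "\<gamma> n \<equiv> coeff (p n) n"

lemma L_diff: "L (f - g) = L f - L g"
  using L_add[of "f - g" g] by simp

lemma L_0: "L 0 = 0"
  using L_smult[of 0 0] by simp

lemma \<gamma>_pos: "\<gamma> n > 0"
  using lead_coeff_p[of n] by (simp add: degree_p)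

lemma coeff_p_above: "n < i \<Longrightarrow> coeff (p n) i = 0"
  by (simp add: coeff_eq_0 degree_p)

lemma a_pos: "a (Suc n) > 0"
  using rec_coeffs by (simp add: recurrence_coeffs_def)

lemma recurrence:
  "[:0, 1:] * p n = smult (a (Suc n)) (p (Suc n)) + smult (b n) (p n) +
     (if n = 0 then 0 else smult (a n) (p (n - 1)))"
  using rec_coeffs by (simp add: recurrence_coeffs_def)

text \<open>The two facts feed each other: if \<open>p\<^sub>n\<close> has a parity, then \<open>x p\<^sub>n\<^sup>2\<close> is odd and
  \<open>b\<^sub>n = L (x p\<^sub>n\<^sup>2)\<close> vanishes; and without the diagonal term the recurrence hands the parity on.\<close>

lemma reflect_p: "p n \<circ>\<^sub>p [:0, -1:] = smult ((-1) ^ n) (p n)" and b_eq_0: "b n = 0"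
proof -
  have b0: "b n = 0" if refl: "p n \<circ>\<^sub>p [:0, -1:] = smult ((-1) ^ n) (p n)" for n
  proof -
    have "([:0, 1:] * p n * p n) \<circ>\<^sub>p [:0, -1:] = - ([:0, 1:] * p n * p n)"
      by (simp only: pcompose_mult refl) (simp add: pcompose_pCons flip: power_mult_distrib)
    hence "L ([:0, 1:] * p n * p n) = L (smult (-1) ([:0, 1:] * p n * p n))"
      using L_reflect[of "[:0, 1:] * p n * p n"] by simp
    hence "L ([:0, 1:] * p n * p n) = 0" by (simp only: L_smult)
    moreover have "L ([:0, 1:] * p n * p n) = b n"
      unfolding recurrence by (cases n) (auto simp: distrib_right L_add L_smult ortho L_0)
    ultimately show ?thesis by simp
  qed
  have "p n \<circ>\<^sub>p [:0, -1:] = smult ((-1) ^ n) (p n)"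
  proof (induction n rule: less_induct)
    case (less n)
    show ?case
    proof (cases n)
      case 0
      have "degree (p 0) = 0" by (rule degree_p)
      then obtain d where "p 0 = [:d:]" by (elim degree_eq_zeroE)
      thus ?thesis using 0 by simp
    next
      case (Suc m)
      have bm: "b m = 0" by (rule b0) (use less.IH Suc in auto)
      have eq: "smult (a (Suc m)) (p (Suc m)) =
          [:0, 1:] * p m - (if m = 0 then 0 else smult (a m) (p (m - 1)))"
        unfolding recurrence[of m] bm by simp
      have IH1: "p m \<circ>\<^sub>p [:0, -1:] = smult ((-1) ^ m) (p m)" using less.IH Suc by auto
      have IH2: "p (m - 1) \<circ>\<^sub>p [:0, -1:] = smult ((-1) ^ (m - 1)) (p (m - 1))"
        using less.IH Suc by auto
      have "smult (a (Suc m)) (p (Suc m) \<circ>\<^sub>p [:0, -1:]) =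
          ([:0, 1:] * p m - (if m = 0 then 0 else smult (a m) (p (m - 1)))) \<circ>\<^sub>p [:0, -1:]"
        by (simp only: flip: eq pcompose_smult)
      also have "\<dots> = smult ((-1) ^ Suc m) (smult (a (Suc m)) (p (Suc m)))"
        unfolding eq
        by (cases m) (use IH1 IH2 in \<open>auto simp: pcompose_diff pcompose_mult pcompose_smult
          pcompose_pCons smult_diff_right mult.commute\<close>)
      finally have "smult (a (Suc m)) (p (Suc m) \<circ>\<^sub>p [:0, -1:] - smult ((-1) ^ Suc m) (p (Suc m))) = 0"
        unfolding smult_diff_right by (simp add: mult.commute)
      thus ?thesis using a_pos[of m] Suc by (simp del: power_Suc)
    qed
  qed
  thus "p n \<circ>\<^sub>p [:0, -1:] = smult ((-1) ^ n) (p n)" and "b n = 0" by (auto intro: b0)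
qed

lemma coeff_p_odd: "odd (n + k) \<Longrightarrow> coeff (p n) k = 0"
  using arg_cong[OF reflect_p[of n], of "\<lambda>f. coeff f k"]
  by (auto simp: coeff_pcompose_linear uminus_power_if split: if_splits)

lemma x_p_0: "[:0, 1:] * p 0 = smult (a 1) (p 1)"
  using recurrence[of 0] by (simp add: b_eq_0)

lemma x_p_Suc: "[:0, 1:] * p (Suc n) = smult (a (Suc (Suc n))) (p (Suc (Suc n))) + smult (a (Suc n)) (p n)"
  using recurrence[of "Suc n"] by (simp add: b_eq_0)

lemma \<gamma>_Suc: "\<gamma> n = a (Suc n) * \<gamma> (Suc n)"
proof (cases n)
  case 0
  thus ?thesis using arg_cong[OF x_p_0, of "\<lambda>f. coeff f 1"] by simp
next
  case (Suc m)
  thus ?thesis using arg_cong[OF x_p_Suc[of m], of "\<lambda>f. coeff f (Suc (Suc m))"]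
    by (simp add: coeff_p_above)
qed

lemma \<gamma>_ratio: "\<gamma> n / \<gamma> (n + 2) = a (n + 1) * a (n + 2)"
  using \<gamma>_pos[of "n + 2"] \<gamma>_Suc[of n] \<gamma>_Suc[of "Suc n"] by simp

lemma asq_sum_simps: "asq_sum 0 = 0" "asq_sum (Suc 0) = 0" "asq_sum (Suc n) = asq_sum n + asq n"
  by (simp_all add: asq_sum_def asq_def)

text \<open>Comparing coefficients of \<open>x\<^sup>n\<^sup>-\<^sup>1\<close> in the three-term recurrence shows that the ratio of the
  two highest coefficients changes by \<open>a\<^sub>n\<^sup>2\<close> at each step.\<close>

lemma subleading_coeff: "coeff (p (n + 2)) n = - \<gamma> (n + 2) * asq_sum (n + 2)"
proof (induction n)
  case 0
  have "0 = a 2 * coeff (p 2) 0 + a 1 * \<gamma> 0"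
    using arg_cong[OF x_p_Suc[of 0], of "\<lambda>f. coeff f 0"] by (simp add: numeral_eq_Suc)
  hence "a 2 * coeff (p 2) 0 = a 2 * (- \<gamma> 2 * asq_sum 2)"
    using \<gamma>_Suc[of 0] \<gamma>_Suc[of 1] by (simp add: numeral_eq_Suc asq_sum_simps asq_def power2_eq_square algebra_simps)
  thus ?case using a_pos[of 1] unfolding mult_cancel_left by (auto simp: numeral_eq_Suc)
next
  case (Suc n)
  have "coeff (p (n + 2)) n = a (n + 3) * coeff (p (n + 3)) (Suc n) + a (n + 2) * \<gamma> (Suc n)"
    using arg_cong[OF x_p_Suc[of "Suc n"], of "\<lambda>f. coeff f (Suc n)"] by (simp add: numeral_eq_Suc)
  hence "a (n + 3) * coeff (p (n + 3)) (Suc n) = a (n + 3) * (- \<gamma> (n + 3) * asq_sum (n + 3))"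
    using Suc.IH \<gamma>_Suc[of "Suc n"] \<gamma>_Suc[of "Suc (Suc n)"]
    by (simp add: numeral_eq_Suc asq_sum_simps(3)[of "Suc (Suc n)"] asq_def power2_eq_square algebra_simps)
  thus ?case using a_pos[of "n + 2"] unfolding mult_cancel_left by (auto simp: numeral_eq_Suc)
qed

lemma L_p_mult_low: "\<forall>i\<ge>n. coeff f i = 0 \<Longrightarrow> L (p n * f) = 0"
proof -
  have "m \<le> n \<Longrightarrow> \<forall>i\<ge>m. coeff f i = 0 \<Longrightarrow> L (p n * f) = 0" for m f
  proof (induction m arbitrary: f)
    case 0
    hence "f = 0" by (intro poly_eqI) auto
    thus ?case by (simp add: L_0)
  next
    case (Suc m)
    define r where "r = f - smult (coeff f m / \<gamma> m) (p m)"
    have "\<forall>i\<ge>m. coeff r i = 0"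
    proof (intro allI impI)
      fix i assume "i \<ge> m"
      then consider "i = m" | "i \<ge> Suc m" by linarith
      thus "coeff r i = 0"
        by cases (use Suc.prems \<gamma>_pos[of m] in \<open>auto simp: r_def coeff_p_above\<close>)
    qed
    hence "L (p n * r) = 0" using Suc by simp
    moreover have "p n * f = p n * r + smult (coeff f m / \<gamma> m) (p n * p m)"
      by (simp add: r_def right_diff_distrib)
    ultimately show ?case using Suc.prems by (simp add: L_add L_smult ortho)
  qed
  thus "\<forall>i\<ge>n. coeff f i = 0 \<Longrightarrow> L (p n * f) = 0" by blast
qed

lemma L_p_mult_same:
  assumes "\<forall>i>n. coeff f i = 0"
  shows "L (p n * f) = coeff f n / \<gamma> n"
proof -
  define r where "r = f - smult (coeff f n / \<gamma> n) (p n)"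
  have "\<forall>i\<ge>n. coeff r i = 0"
    using assms \<gamma>_pos[of n] by (auto simp: r_def coeff_p_above le_less)
  hence "L (p n * r) = 0" by (rule L_p_mult_low)
  moreover have "p n * f = p n * r + smult (coeff f n / \<gamma> n) (p n * p n)"
    by (simp add: r_def right_diff_distrib)
  ultimately show ?thesis by (simp add: L_add L_smult ortho)
qed

text \<open>Subtracting a multiple of \<open>p\<^sub>n\<^sub>+\<^sub>2\<close> leaves degree \<open>n\<close>, so that the integral is read off from
  two coefficients of \<open>f\<close>. This spares any expansion of \<open>p\<^sub>n (q x)\<close> or \<open>p\<^sub>n (x / q)\<close> in
  orthogonal polynomials.\<close>

lemma L_p_mult_high:
  assumes "\<forall>i>n + 2. coeff f i = 0" "coeff f (n + 1) = 0"
  shows "L (p n * f) = (coeff f n + asq_sum (n + 2) * coeff f (n + 2)) / \<gamma> n"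
proof -
  define k where "k = coeff f (n + 2) / \<gamma> (n + 2)"
  define r where "r = f - smult k (p (n + 2))"
  have "\<forall>i>n. coeff r i = 0"
  proof (intro allI impI)
    fix i assume "i > n"
    then consider "i = n + 1" | "i = n + 2" | "i > n + 2" by linarith
    thus "coeff r i = 0"
      by cases (use assms \<gamma>_pos[of "n + 2"] coeff_p_odd[of "n + 2" "n + 1"] in
        \<open>auto simp: r_def k_def coeff_p_above\<close>)
  qed
  hence "L (p n * r) = coeff r n / \<gamma> n" by (rule L_p_mult_same)
  moreover have "p n * f = p n * r + smult k (p n * p (n + 2))"
    by (simp add: r_def right_diff_distrib)
  ultimately have "L (p n * f) = coeff r n / \<gamma> n" by (simp add: L_add L_smult ortho)
  also have "coeff r n = coeff f n + asq_sum (n + 2) * coeff f (n + 2)"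
    using \<gamma>_pos[of "n + 2"] by (simp add: r_def k_def subleading_coeff del: add_2_eq_Suc')
  finally show ?thesis .
qed

lemma moment_4: "L (p 0 * p 0 * monom 1 4) = asq 1 * (asq 1 + asq 2)"
proof -
  let ?f = "monom 1 2 * p 0"
  have cf: "coeff ?f i = (if i = 2 then \<gamma> 0 else 0)" for i
    by (auto simp: coeff_monom_mult coeff_p_above)
  have m: "monom 1 2 = [:0, 1:] * [:0, 1 :: real:]" by (simp add: monom_altdef power2_eq_square)
  have f: "?f = smult (a 1 * a 2) (p 2) + smult ((a 1)\<^sup>2) (p 0)"
  proof -
    have "?f = [:0, 1:] * ([:0, 1:] * p 0)" by (simp add: m mult.assoc)
    also have "\<dots> = smult (a 1) ([:0, 1:] * p 1)" unfolding x_p_0 by (rule mult_smult_right)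
    also have "[:0, 1:] * p 1 = smult (a 2) (p 2) + smult (a 1) (p 0)"
      using x_p_Suc[of 0] by (simp add: numeral_eq_Suc)
    finally show ?thesis by (simp add: smult_add_right power2_eq_square)
  qed
  have "p 0 * p 0 * monom 1 4 = ?f * ?f"
  proof -
    have "monom 1 4 = monom 1 2 * monom (1 :: real) 2" by (simp add: mult_monom)
    thus ?thesis by (simp only: mult_ac)
  qed
  also have "L \<dots> = a 1 * a 2 * L (p 2 * ?f) + (a 1)\<^sup>2 * L (p 0 * ?f)"
    by (subst f) (simp only: distrib_right mult_smult_left L_add L_smult)
  also have "L (p 2 * ?f) = \<gamma> 0 / \<gamma> 2"
    by (subst L_p_mult_same) (auto simp: cf)
  also have "\<gamma> 0 / \<gamma> 2 = a 1 * a 2"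
    using \<gamma>_ratio[of 0] by (simp only: add_0)
  also have "L (p 0 * ?f) = asq_sum 2"
    using L_p_mult_high[of 0 ?f] \<gamma>_pos[of 0] by (simp only: cf add_0) simp
  also have "asq_sum 2 = asq 1" by (simp add: numeral_eq_Suc asq_sum_simps asq_def)
  also have "a 1 * a 2 * (a 1 * a 2) + (a 1)\<^sup>2 * asq 1 = asq 1 * (asq 1 + asq 2)"
    by (simp add: asq_def power2_eq_square algebra_simps)
  finally show ?thesis .
qed

section \<open>Consequences of the scaling identity\<close>

context
  fixes q Q :: real
  assumes q_pos: "q > 0"
    and L_scale: "q * Q * L (f \<circ>\<^sub>p [:0, q:]) = L (f * (1 - monom 1 4))"
begin

lemma first_relation: "asq 1 * (asq 1 + asq 2) = 1 - q * Q"
proof -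
  have "degree (p 0) = 0" by (rule degree_p)
  then obtain d where d: "p 0 = [:d:]" by (elim degree_eq_zeroE)
  have const: "(p 0 * p 0) \<circ>\<^sub>p [:0, q:] = p 0 * p 0" by (simp add: d)
  have norm: "L (p 0 * p 0) = 1" by (simp add: ortho)
  have "p 0 * p 0 * (1 - monom 1 4) = p 0 * p 0 - p 0 * p 0 * monom 1 4"
    by (simp only: right_diff_distrib mult_1_right)
  hence "q * Q * 1 = 1 - L (p 0 * p 0 * monom 1 4)"
    using L_scale[of "p 0 * p 0"] unfolding const norm by (simp only: L_diff norm)
  thus ?thesis unfolding moment_4 by linarith
qed

text \<open>Up to a common factor, both sides evaluate \<open>L (p\<^sub>n\<^sub>+\<^sub>2 (q x) p\<^sub>n x)\<close>. The left one uses that \<open>p\<^sub>n\<^sub>+\<^sub>2 (q x)\<close> has degree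
  \<open>n + 2\<close>; the right one moves the dilation to \<open>p\<^sub>n\<close> by the scaling identity, where
  orthogonality removes \<open>p\<^sub>n (x / q)\<close> and leaves \<open>x\<^sup>4 p\<^sub>n (x / q)\<close>, of degree \<open>n + 4\<close>.\<close>

lemma sum_relation:
  "q * Q * (1 - q\<^sup>2) * q ^ (2 * n) * asq_sum (n + 2) =
    asq (n + 1) * asq (n + 2) * (asq_sum (n + 4) - q\<^sup>2 * asq_sum n)"
proof -
  define P where "P = p (n + 2) \<circ>\<^sub>p [:0, q:]"
  define g where "g = p n \<circ>\<^sub>p [:0, inverse q:]"
  have cP: "coeff P i = q ^ i * coeff (p (n + 2)) i" for i
    by (simp add: P_def coeff_pcompose_linear)
  have cg: "coeff g i = inverse q ^ i * coeff (p n) i" for i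
    by (simp add: g_def coeff_pcompose_linear)
  have "g \<circ>\<^sub>p [:0, q:] = p n"
    using q_pos by (simp add: g_def pcompose_pCons flip: pcompose_assoc)
  hence "q * Q * L (p n * P) = L (p (n + 2) * g * (1 - monom 1 4))"
    using L_scale[of "p (n + 2) * g"] by (simp add: pcompose_mult P_def mult.commute)
  also have "p (n + 2) * g * (1 - monom 1 4) = p (n + 2) * g - p (n + 2) * (monom 1 4 * g)"
    by (simp add: algebra_simps)
  also have "L \<dots> = - L (p (n + 2) * (monom 1 4 * g))"
    using L_p_mult_low[of "n + 2" g] by (simp add: L_diff cg coeff_p_above)
  finally have eq: "q * Q * L (p n * P) = - L (p (n + 2) * (monom 1 4 * g))" .
  have "L (p n * P) = (q ^ n * coeff (p (n + 2)) n + asq_sum (n + 2) * (q ^ (n + 2) * \<gamma> (n + 2))) / \<gamma> n"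
    by (subst L_p_mult_high) (auto simp: cP coeff_p_above coeff_p_odd)
  also have "\<dots> = - (\<gamma> (n + 2) / \<gamma> n * q ^ n * (1 - q\<^sup>2) * asq_sum (n + 2))"
    using \<gamma>_pos[of n] unfolding subleading_coeff
    by (simp add: field_simps power_add power2_eq_square)
  finally have lhs: "L (p n * P) = - (\<gamma> (n + 2) / \<gamma> n * q ^ n * (1 - q\<^sup>2) * asq_sum (n + 2))" .
  have coeff_low: "coeff (monom 1 4 * g) (n + 2) = - (inverse q ^ n * q\<^sup>2 * \<gamma> n * asq_sum n)"
  proof (cases "n < 2")
    case True
    hence "n = 0 \<or> n = 1" by auto
    thus ?thesis by (auto simp: coeff_monom_mult asq_sum_simps asq_def)
  next
    case False
    then obtain m where m: "n = m + 2" by (metis add.commute le_Suc_ex not_less)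
    have "inverse q ^ 2 * q\<^sup>2 = 1" using q_pos by (simp flip: power_mult_distrib)
    hence "inverse q ^ m = inverse q ^ n * q\<^sup>2" by (simp only: m power_add mult.assoc mult_1_right)
    moreover have "coeff (monom 1 4 * g) (n + 2) = inverse q ^ m * coeff (p n) m"
      by (simp add: m coeff_monom_mult cg)
    ultimately show ?thesis using subleading_coeff[of m] unfolding m by (simp only: mult_ac mult_minus_left mult_minus_right)
  qed
  have "L (p (n + 2) * (monom 1 4 * g)) =
      (coeff (monom 1 4 * g) (n + 2) + asq_sum (n + 4) * coeff g n) / \<gamma> (n + 2)"
  proof -
    have "coeff (p n) (n - 1) = 0" if "n > 0" using that by (intro coeff_p_odd) auto
    thus ?thesis
      by (subst L_p_mult_high) (auto simp: cg coeff_monom_mult coeff_p_above numeral_eq_Suc)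
  qed
  also have "\<dots> = \<gamma> n / \<gamma> (n + 2) * inverse q ^ n * (asq_sum (n + 4) - q\<^sup>2 * asq_sum n)"
  proof -
    have "(- (i * r * x * u) + v * (i * x)) / z = x / z * i * (v - r * u)" for i r u v x z :: real
      by (cases "z = 0") (simp, simp add: divide_simps, simp add: algebra_simps)
    thus ?thesis unfolding coeff_low cg .
  qed
  finally have rhs: "L (p (n + 2) * (monom 1 4 * g)) =
      \<gamma> n / \<gamma> (n + 2) * inverse q ^ n * (asq_sum (n + 4) - q\<^sup>2 * asq_sum n)" .
  define h where "h = \<gamma> n / \<gamma> (n + 2)"
  have h: "h > 0" "\<gamma> (n + 2) / \<gamma> n = inverse h"
    using \<gamma>_pos[of n] \<gamma>_pos[of "n + 2"] by (simp_all add: h_def)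
  have h_sq: "h * h = asq (n + 1) * asq (n + 2)"
    unfolding h_def \<gamma>_ratio by (simp add: asq_def power2_eq_square)
  have "h * q ^ n * (q * Q * (inverse h * q ^ n * (1 - q\<^sup>2) * asq_sum (n + 2))) =
      h * q ^ n * (h * inverse q ^ n * (asq_sum (n + 4) - q\<^sup>2 * asq_sum n))"
    using eq unfolding lhs rhs mult_minus_right neg_equal_iff_equal h(2) h_def[symmetric]
    by (rule arg_cong)
  moreover have "h * q ^ n * (q * Q * (inverse h * q ^ n * (1 - q\<^sup>2) * asq_sum (n + 2))) =
      (h * inverse h) * (q * Q * (1 - q\<^sup>2) * q ^ (2 * n) * asq_sum (n + 2))"
    unfolding mult_2 power_add by (simp only: mult_ac)
  moreover have "h * q ^ n * (h * inverse q ^ n * (asq_sum (n + 4) - q\<^sup>2 * asq_sum n)) =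
      (q ^ n * inverse q ^ n) * (h * h * (asq_sum (n + 4) - q\<^sup>2 * asq_sum n))"
    by (simp only: mult_ac)
  moreover have "h * inverse h = 1" "q ^ n * inverse q ^ n = 1"
    using h(1) q_pos by (simp_all add: power_inverse)
  ultimately show ?thesis by (simp only: h_sq mult_1_left)
qed

end

end

section \<open>Integrating the relation for the sums\<close>

text \<open>In the two induction steps \<open>z, u, v, w\<close> stand for \<open>y\<^sub>n\<^sub>-\<^sub>2, y\<^sub>n\<^sub>-\<^sub>1, y\<^sub>n, y\<^sub>n\<^sub>+\<^sub>1\<close>, \<open>t\<close> for
  \<open>q\<^sup>n\<^sup>-\<^sup>1\<close> and \<open>S\<close> for \<open>(1 - q\<^sup>2) s\<^sub>n\<close>. Each step exhibits the conclusion, multiplied by a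
  nonzero factor, as a polynomial combination of the hypotheses. The parity of \<open>n\<close> enters only
  through the exchange of \<open>A\<close> and \<open>B\<close>.\<close>

lemma qdP_step_add:
  fixes u v w A B D D' Q S q t :: real
  assumes "D = u * v + Q" "D > 0" "D' = v * w + Q"
    and F: "D * (S + t * (v + q * u)) = A * u + B * v"
    and St: "q * t * D * D' = Q * A - B * v\<^sup>2"
    and S': "S' = S + (1 - q\<^sup>2) * t * v"
  shows "D' * (S' + q * t * (w + q * v)) = B * v + A * w"
proof -
  have "D * (D' * (S' + q * t * (w + q * v)) - (B * v + A * w)) =
      D' * (D * (S + t * (v + q * u)) - (A * u + B * v)) +
      (q * t * D * D' - (Q * A - B * v\<^sup>2)) * (w - u)"
    unfolding assms(1,3) S' by (simp add: algebra_simps power2_eq_square)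
  also have "\<dots> = 0" using F St by simp
  finally show ?thesis using assms(2) by simp
qed

lemma qdP_step_mult:
  fixes u v w z A B D S Q q t :: real
  assumes "D = u * v + Q" "u \<noteq> 0"
    and F: "D * (S + t * (v + q * u)) = A * u + B * v"
    and St: "t * (z * u + Q) * D = Q * B - A * u\<^sup>2"
    and E: "Q * S = u * v * (S + q * t * w + t * v + q * t * u + t * z)"
  shows "q * t * D * (v * w + Q) = Q * A - B * v\<^sup>2"
proof -
  have "u * (q * t * D * (v * w + Q) - (Q * A - B * v\<^sup>2)) =
      (Q - u * v) * (D * (S + t * (v + q * u)) - (A * u + B * v)) -
      v * (t * (z * u + Q) * D - (Q * B - A * u\<^sup>2)) -
      D * (Q * S - u * v * (S + q * t * w + t * v + q * t * u + t * z))"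
    unfolding assms(1) by (simp add: algebra_simps power2_eq_square)
  also have "\<dots> = 0" using F St E by simp
  finally show ?thesis using assms(2) by simp
qed

text \<open>The induction starts at index \<open>1\<close>: since \<open>y\<^sub>0 = 0\<close>, the step that cancels \<open>y\<^sub>n\<^sub>-\<^sub>1\<close> cannot
  yield the claim there, and the initial condition takes its place. In the proof \<open>D n\<close>,
  \<open>St n\<close> and \<open>F n\<close> belong to the index \<open>n + 1\<close> of the induction described at the top.\<close>

lemma qdP_recurrence:
  fixes y s :: "nat \<Rightarrow> real" and q Q :: real
  defines "A \<equiv> \<lambda>n::nat. if even n then Q else 1"
  assumes q: "q > 0" and Q: "Q > 0" and y0: "y 0 = 0" and ypos: "\<And>n. n \<ge> 1 \<Longrightarrow> y n > 0"
    and s0: "s 0 = 0" and s_Suc: "\<And>n. q * (s (Suc n) - s n) = q ^ n * y n"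
    and base: "y 1 * (y 1 + q * y 2) = 1 - q * Q"
    and E: "\<And>n. Q * (1 - q\<^sup>2) * s (n + 2) = y (n + 2) * y (n + 1) * (s (n + 4) - q\<^sup>2 * s n)"
  shows "q ^ Suc n * (y (Suc n) * y n + Q) * (y (Suc n) * y (n + 2) + Q) =
    Q * A (Suc n) - A n * (y (Suc n))\<^sup>2"
proof -
  define D where "D = (\<lambda>n. y n * y (Suc n) + Q)"
  have ynn: "y n \<ge> 0" for n using ypos[of n] y0 by (cases n) auto
  have D: "D n > 0" for n using ynn[of n] ynn[of "Suc n"] Q by (simp add: D_def add_nonneg_pos)
  have s_add: "s (Suc (Suc n)) = s (Suc n) + q ^ n * y (Suc n)" for n
    proof -
    have "q * (s (Suc (Suc n)) - (s (Suc n) + q ^ n * y (Suc n))) = 0"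
      using s_Suc[of "Suc n"] by (simp add: algebra_simps)
    thus ?thesis using q by simp
  qed
  have s1: "s (Suc 0) = 0" using s_Suc[of 0] q s0 y0 by simp
  define St where "St = (\<lambda>n. q ^ Suc n * D n * D (Suc n) = Q * A (Suc n) - A n * (y (Suc n))\<^sup>2)"
  define F where "F = (\<lambda>n. D n * ((1 - q\<^sup>2) * s (Suc n) + q ^ n * (y (Suc n) + q * y n)) =
      A (Suc n) * y n + A n * y (Suc n))"
  have F_Suc: "F (Suc n)" if "F n" "St n" for n
    using qdP_step_add[of "D n" "y n" "y (Suc n)" Q "D (Suc n)" "y (Suc (Suc n))"
        "(1 - q\<^sup>2) * s (Suc n)" "q ^ n" q "A (Suc n)" "A n" "(1 - q\<^sup>2) * s (Suc (Suc n))"] D that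
    unfolding F_def St_def by (simp add: D_def A_def s_add algebra_simps)
  have St_Suc: "St (Suc n)" if St: "St n" and F: "F (Suc n)" for n
  proof -
    have "Q * ((1 - q\<^sup>2) * s (Suc (Suc n))) = y (Suc n) * y (Suc (Suc n)) *
        ((1 - q\<^sup>2) * s (Suc (Suc n)) + q * q ^ Suc n * y (Suc (Suc (Suc n))) + q ^ Suc n * y (Suc (Suc n))
          + q * q ^ Suc n * y (Suc n) + q ^ Suc n * y n)"
    proof -
      have "s (n + 4) = s (Suc (Suc n)) + q ^ Suc n * y (Suc (Suc n)) + q * q ^ Suc n * y (Suc (Suc (Suc n)))"
        using s_add[of "Suc n"] s_add[of "Suc (Suc n)"] by (simp add: numeral_eq_Suc)
      moreover have "q\<^sup>2 * s n = q\<^sup>2 * s (Suc (Suc n)) - q * q ^ Suc n * y (Suc n) - q ^ Suc n * y n"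
        using s_add[of n] s_Suc[of n] by (simp add: algebra_simps power2_eq_square)
      ultimately have s_diff: "s (n + 4) - q\<^sup>2 * s n = (1 - q\<^sup>2) * s (Suc (Suc n)) +
          q * q ^ Suc n * y (Suc (Suc (Suc n))) + q ^ Suc n * y (Suc (Suc n)) +
          q * q ^ Suc n * y (Suc n) + q ^ Suc n * y n"
        by (simp add: left_diff_distrib)
      show ?thesis using E[of n] unfolding s_diff by (simp add: mult_ac)
    qed
    thus ?thesis
      using qdP_step_mult[of "D (Suc n)" "y (Suc n)" "y (Suc (Suc n))" Q "(1 - q\<^sup>2) * s (Suc (Suc n))"
          "q ^ Suc n" q "A n" "A (Suc n)" "y n" "y (Suc (Suc (Suc n)))"] ypos[of "Suc n"] that
      unfolding F_def St_def by (simp add: D_def A_def mult_ac)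
  qed
  have F0: "F 0" using y0 s1 by (simp add: F_def A_def D_def)
  have "Q * (y 1 * (y 1 + q * y 2)) = Q * (1 - q * Q)" using base by simp
  hence St0: "St 0" using y0
    by (simp add: St_def A_def D_def numeral_eq_Suc algebra_simps)
  have "St n \<and> F n"
    by (induction n) (use F0 St0 F_Suc St_Suc in blast)+
  thus ?thesis by (simp add: St_def D_def mult_ac)
qed

section \<open>The recurrence coefficients\<close>

theorem mainTheorem1:
  fixes q \<alpha> :: real and p :: "nat \<Rightarrow> real poly" and a b y :: "nat \<Rightarrow> real"
  assumes "0 < q" and "q < 1" and "\<alpha> > -1"
    and "orthonormal_polys q (freud_weight q \<alpha>) p"
    and "recurrence_coeffs p a b"
    and "y 0 = 0"
    and "\<And>n. n \<ge> 1 \<Longrightarrow> y n = (a n)\<^sup>2 * q powr (1 - real n)"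
  shows "(\<forall>n. b n = 0) \<and>
    (\<forall>n\<ge>1. q powr (real n - \<alpha>) * (y n * y (n + 1) + q powr \<alpha>) * (y n * y (n - 1) + q powr \<alpha>) =
      (if even n then q powr \<alpha> - q powr (- \<alpha>) * (y n)\<^sup>2 else 1 - (y n)\<^sup>2))"
proof -
  define Q where "Q = q powr \<alpha>"
  have Q: "Q > 0" using assms(1) by (simp add: Q_def)
  interpret even_orthonormal "freud_functional q \<alpha>" p a b
  proof
    show "freud_functional q \<alpha> (f + g) = freud_functional q \<alpha> f + freud_functional q \<alpha> g" for f g
      by (rule freud_functional_add[OF assms(1-3)])
    show "freud_functional q \<alpha> (smult k f) = k * freud_functional q \<alpha> f" for k f
      by (rule freud_functional_smult[OF assms(1-3)])
    show "freud_functional q \<alpha> (f \<circ>\<^sub>p [:0, -1:]) = freud_functional q \<alpha> f" for f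
      by (rule freud_functional_reflect)
    show "degree (p n) = n" "lead_coeff (p n) > 0" for n
      using assms(4) unfolding orthonormal_polys_def by blast+
    show "freud_functional q \<alpha> (p n * p m) = (if m = n then 1 else 0)" for m n
      using assms(4) by (simp add: freud_functional_def orthonormal_polys_def)
    show "recurrence_coeffs p a b" by (rule assms(5))
  qed
  have scale: "q * Q * freud_functional q \<alpha> (f \<circ>\<^sub>p [:0, q:]) =
      freud_functional q \<alpha> (f * (1 - monom 1 4))" for f
    unfolding Q_def by (rule freud_functional_scale[OF assms(1-3)])
  have asq_y: "q * asq n = q ^ n * y n" for n
  proof (cases "n = 0")
    case True
    thus ?thesis using assms(6) by (simp add: asq_def)
  next
    case False
    have "q ^ n * q powr (1 - real n) = q"
      using assms(1) by (simp add: powr_diff powr_realpow)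
    thus ?thesis using False assms(7)[of n] by (simp add: asq_def mult.commute mult.left_commute)
  qed
  have asq_y_Suc: "asq (Suc n) = q ^ n * y (Suc n)" for n
    using asq_y[of "Suc n"] assms(1) by simp
  have y_pos: "y n > 0" if "n \<ge> 1" for n
    using assms(7)[OF that] a_pos[of "n - 1"] assms(1) that by simp
  have base: "y 1 * (y 1 + q * y 2) = 1 - q * Q"
    using first_relation[OF assms(1) scale] asq_y_Suc[of 0] asq_y_Suc[of 1]
    by (simp add: numeral_2_eq_2)
  have sums: "Q * (1 - q\<^sup>2) * asq_sum (n + 2) =
      y (n + 2) * y (n + 1) * (asq_sum (n + 4) - q\<^sup>2 * asq_sum n)" for n
  proof -
    have "(q * q ^ (2 * n)) * (Q * (1 - q\<^sup>2) * asq_sum (n + 2)) =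
        asq (n + 1) * asq (n + 2) * (asq_sum (n + 4) - q\<^sup>2 * asq_sum n)"
      using sum_relation[OF assms(1) scale, of n] by (simp only: mult_ac)
    also have "asq (n + 1) * asq (n + 2) = (q * q ^ (2 * n)) * (y (n + 2) * y (n + 1))"
      using asq_y_Suc[of n] asq_y_Suc[of "Suc n"] by (simp add: mult_2 power_add)
    finally show ?thesis using assms(1) by simp
  qed
  have rec: "q ^ Suc n * (y (Suc n) * y n + Q) * (y (Suc n) * y (n + 2) + Q) =
      Q * (if even (Suc n) then Q else 1) - (if even n then Q else 1) * (y (Suc n))\<^sup>2" for n
    by (rule qdP_recurrence[where s = asq_sum])
       (use assms(1,6) Q y_pos base sums asq_y in \<open>auto simp: asq_sum_simps\<close>)
  have "q powr (real n - \<alpha>) * (y n * y (n + 1) + q powr \<alpha>) * (y n * y (n - 1) + q powr \<alpha>) =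
      (if even n then q powr \<alpha> - q powr (- \<alpha>) * (y n)\<^sup>2 else 1 - (y n)\<^sup>2)" if "n \<ge> 1" for n
  proof -
    obtain m where m: "n = Suc m" using \<open>n \<ge> 1\<close> by (auto simp: Suc_le_eq gr0_conv_Suc)
    have "q powr (real n - \<alpha>) = q ^ n / Q" "q powr (- \<alpha>) = 1 / Q"
      using assms(1) by (simp_all add: Q_def powr_diff powr_realpow powr_minus_divide)
    moreover have "q ^ n / Q * (y n * y (n + 1) + Q) * (y n * y (n - 1) + Q) =
        (Q * (if even n then Q else 1) - (if even m then Q else 1) * (y n)\<^sup>2) / Q"
      using rec[of m] by (simp add: m mult_ac)
    moreover have "\<dots> = (if even n then Q - 1 / Q * (y n)\<^sup>2 else 1 - (y n)\<^sup>2)"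
      using Q by (simp add: m diff_divide_distrib)
    ultimately show ?thesis by (simp only: Q_def)
  qed
  thus ?thesis using b_eq_0 by blast
qed

end
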